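(* Let $k \geq 2$ and let $(\mathcal{H}_n)_{n \in \mathbb{N}}$ be a sequence of $k$-uniform hypergraphs satisfying, as $n \to \infty$, (M1) $\Delta_1(\mathcal{H}_n) = O(d(\mathcal{H}_n))$, (M2) $\Delta_2(\mathcal{H}_n) = o(d(\mathcal{H}_n))$, and (M3) $d(\mathcal{H}_n) = o(v(\mathcal{H}_n)^{k-1})$. Then the threshold biases satisfy $$q(\mathcal{H}_n) = \Omega\left( \min_{2 \leq \ell \leq k} \left( \frac{d(\mathcal{H}_n)}{\Delta_\ell(\mathcal{H}_n)} \right)^{\frac{1}{\ell-1}} \right).$$
   Context: For a hypergraph $\mathcal{H}$, $v(\mathcal{H})$ is the number of vertices, $e(\mathcal{H})$ the number of edges, and $d(\mathcal{H}) = e(\mathcal{H})/v(\mathcal{H})$ its density. For $S \subseteq V(\mathcal{H})$, $\deg(S)$ is the number of edges containing $S$, and $\Delta_\ell(\mathcal{H}) = \max\{\deg(S) : S \subseteq V(\mathcal{H}), |S| = \ell\}$. For a positive integer $q$, the $q$-biased Maker-Breaker game $\mathbf{G}(\mathcal{H};q)$: Maker and Breaker alternately occupy previously unoccupied vertices of $\mathcal{H}$, Maker first, Maker occupying one vertex per round and Breaker up to $q$ vertices per round; Maker wins if his vertices fully contain some edge of $\mathcal{H}$, Breaker wins otherwise. The threshold bias $q(\mathcal{H})$ is the smallest positive integer $q$ for which Breaker has a winning strategy in $\mathbf{G}(\mathcal{H};q)$. *)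

theory Defs
  imports Complex_Main "HOL-Library.Landau_Symbols"
begin

record 'a hypergraph =
  hverts :: "'a set"
  hedges :: "'a set set"

definition uniform_hypergraph :: "nat \<Rightarrow> 'a hypergraph \<Rightarrow> bool" where
  "uniform_hypergraph k H \<longleftrightarrow>
     finite (hverts H) \<and> (\<forall>e\<in>hedges H. e \<subseteq> hverts H \<and> card e = k)"

definition num_verts :: "'a hypergraph \<Rightarrow> nat" where
  "num_verts H = card (hverts H)"

definition num_edges :: "'a hypergraph \<Rightarrow> nat" where
  "num_edges H = card (hedges H)"

definition density :: "'a hypergraph \<Rightarrow> real" where
  "density H = real (num_edges H) / real (num_verts H)"

definition hdeg :: "'a hypergraph \<Rightarrow> 'a set \<Rightarrow> nat" where
  "hdeg H S = card {e \<in> hedges H. S \<subseteq> e}"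

text \<open>If \<open>H\<close> has fewer than \<open>l\<close> vertices, this is the maximum of an empty set and hence
  unspecified. For a \<open>k\<close>-uniform \<open>H\<close> and \<open>l \<le> k\<close> this requires \<open>H\<close> to have no edges at all.\<close>

definition max_deg :: "nat \<Rightarrow> 'a hypergraph \<Rightarrow> nat" where
  "max_deg l H = Max {hdeg H S | S. S \<subseteq> hverts H \<and> card S = l}"


text \<open>A history is the list of completed rounds, oldest first; each round consists of Maker's vertex
  and the set of vertices with which Breaker replies.\<close>

type_synonym 'a history = "('a \<times> 'a set) list"

definition maker_set :: "'a history \<Rightarrow> 'a set" where
  "maker_set h = fst ` set h"

definition breaker_set :: "'a history \<Rightarrow> 'a set" where
  "breaker_set h = \<Union> (snd ` set h)"

definition free_verts :: "'a hypergraph \<Rightarrow> 'a history \<Rightarrow> 'a set" where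
  "free_verts H h = hverts H - (maker_set h \<union> breaker_set h)"

text \<open>A strategy of Breaker maps the history and Maker's move in the current round to Breaker's
  reply.\<close>

type_synonym 'a breaker_strategy = "'a history \<Rightarrow> 'a \<Rightarrow> 'a set"

inductive play_against :: "'a hypergraph \<Rightarrow> 'a breaker_strategy \<Rightarrow> 'a history \<Rightarrow> bool"
  for H :: "'a hypergraph" and \<sigma> :: "'a breaker_strategy" where
  start: "play_against H \<sigma> []"
| round: "play_against H \<sigma> h \<Longrightarrow> v \<in> free_verts H h \<Longrightarrow> play_against H \<sigma> (h @ [(v, \<sigma> h v)])"

definition legal_breaker_strategy :: "'a hypergraph \<Rightarrow> nat \<Rightarrow> 'a breaker_strategy \<Rightarrow> bool" where
  "legal_breaker_strategy H q \<sigma> \<longleftrightarrow>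
     (\<forall>h v. play_against H \<sigma> h \<longrightarrow> v \<in> free_verts H h \<longrightarrow>
        \<sigma> h v \<subseteq> free_verts H h - {v} \<and> card (\<sigma> h v) \<le> q)"

definition maker_has_won :: "'a hypergraph \<Rightarrow> 'a history \<Rightarrow> bool" where
  "maker_has_won H h \<longleftrightarrow> (\<exists>e\<in>hedges H. e \<subseteq> maker_set h)"

text \<open>Play may be continued after Maker has completed an edge; this changes nothing, since
  \<open>maker_has_won\<close> is preserved when a history is extended.\<close>

definition breaker_wins :: "'a hypergraph \<Rightarrow> nat \<Rightarrow> bool" where
  "breaker_wins H q \<longleftrightarrow>
     (\<exists>\<sigma>. legal_breaker_strategy H q \<sigma> \<and> (\<forall>h. play_against H \<sigma> h \<longrightarrow> \<not> maker_has_won H h))"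

definition threshold_bias :: "'a hypergraph \<Rightarrow> nat" where
  "threshold_bias H = (LEAST q. q > 0 \<and> breaker_wins H q)"

text \<open>For \<open>k \<ge> 2\<close> the minimum in \<open>threshold_bias\<close> exists: a sufficiently strong Breaker answers
  Maker's first move by occupying all remaining vertices.\<close>

lemma breaker_wins_large_bias:
  assumes H: "uniform_hypergraph k H" and k: "k \<ge> 2" and q: "q \<ge> num_verts H"
  shows "breaker_wins H q"
proof -
  define \<sigma> :: "'a breaker_strategy" where "\<sigma> = (\<lambda>h v. free_verts H h - {v})"
  have fin: "finite (hverts H)" using H by (simp add: uniform_hypergraph_def)
  have legal: "legal_breaker_strategy H q \<sigma>"
    unfolding legal_breaker_strategy_def
  proof (intro allI impI conjI)
    fix h v
    show "\<sigma> h v \<subseteq> free_verts H h - {v}" by (simp add: \<sigma>_def)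
    have "card (\<sigma> h v) \<le> card (hverts H)"
      by (rule card_mono[OF fin]) (auto simp: \<sigma>_def free_verts_def)
    then show "card (\<sigma> h v) \<le> q" using q by (simp add: num_verts_def)
  qed
  have short: "h = [] \<or> length h = 1 \<and> free_verts H h = {}" if "play_against H \<sigma> h" for h
    using that
  proof induction
    case start
    show ?case by simp
  next
    case (round h v)
    then have "h = []" by auto
    then show ?case
      by (auto simp: free_verts_def maker_set_def breaker_set_def \<sigma>_def)
  qed
  have "\<not> maker_has_won H h" if "play_against H \<sigma> h" for h
  proof
    assume "maker_has_won H h"
    then obtain e where e: "e \<in> hedges H" "e \<subseteq> maker_set h"
      by (auto simp: maker_has_won_def)
    have "card e \<le> card (maker_set h)"
      using e(2) by (intro card_mono) (simp_all add: maker_set_def)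
    also have "\<dots> \<le> card (set h)" by (simp add: maker_set_def card_image_le)
    also have "\<dots> \<le> length h" by (rule card_length)
    also have "\<dots> \<le> 1" using short[OF that] by auto
    finally show False using e(1) H k by (auto simp: uniform_hypergraph_def)
  qed
  with legal show ?thesis unfolding breaker_wins_def by blast
qed

lemma threshold_bias_pos_wins:
  assumes "uniform_hypergraph k H" and "k \<ge> 2"
  shows "threshold_bias H > 0 \<and> breaker_wins H (threshold_bias H)"
  unfolding threshold_bias_def
  by (rule LeastI[of _ "Suc (num_verts H)"])
    (use breaker_wins_large_bias[OF assms, of "Suc (num_verts H)"] in simp)

end

theory Submission
  imports Defs "HOL-Library.FuncSet"
begin

text \<open>
  Fix a strategy of Breaker and let Maker attempt \<open>M \<approx> \<delta> v / q\<close> vertices chosen independently and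
  uniformly at random. An attempt fails only if Breaker already owns the vertex, which has
  probability at most \<open>q M / v \<le> \<delta>\<close>. If Maker never completes an edge, then every \<open>k\<close>-set of attempts
  that spells an edge contains a failed attempt. The expected number of such \<open>k\<close>-sets is of order
  \<open>Y = e (M / v)\<^sup>k\<close>. The number \<open>D\<^sub>i\<close> of those containing attempt \<open>i\<close> is not bounded pointwise, but
  \<open>\<Delta>\<^sub>l \<le> C d (M / v) ^ (l - 1)\<close> for \<open>1 \<le> l \<le> k\<close> makes its second moment \<open>O((Y / M)\<^sup>2)\<close>. By
  Cauchy-Schwarz the expected sum of \<open>D\<^sub>i\<close> over failed \<open>i\<close> is then \<open>O(\<surd>\<delta> Y)\<close>, less than the first
  moment for small \<open>\<delta>\<close>. Hence some sequence of attempts wins for Maker; a fixed strategy of Breaker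
  needs to be beaten only with positive probability, so no concentration inequality is required.
\<close>

section \<open>Counting functions through their restrictions\<close>

text \<open>A function on \<open>A\<close> is determined by its restrictions to \<open>I\<close> and
  to \<open>A - I\<close>, so \<open>S\<close> embeds into a dependent sum. The fibre may vary with
  the first restriction: later the second edge depends on the image of the first, and Breaker's
  vertices depend on the other attempts.\<close>

lemma card_PiE_le_fibres:
  fixes S :: "('i \<Rightarrow> 'a) set"
  assumes S: "S \<subseteq> A \<rightarrow>\<^sub>E V" and T: "finite T" and I: "I \<subseteq> A"
    and T_in: "\<And>w. w \<in> S \<Longrightarrow> restrict w I \<in> T"
    and F: "\<And>u. u \<in> T \<Longrightarrow> finite (F u) \<and> card (F u) \<le> b"
    and F_in: "\<And>w. w \<in> S \<Longrightarrow> restrict w (A - I) \<in> F (restrict w I)"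
  shows "card S \<le> card T * b"
proof -
  have inj: "inj_on (\<lambda>w. (restrict w I, restrict w (A - I))) S"
  proof (rule inj_onI)
    fix w w' assume w: "w \<in> S" "w' \<in> S"
      and eq: "(restrict w I, restrict w (A - I)) = (restrict w' I, restrict w' (A - I))"
    show "w = w'"
    proof (rule PiE_ext[of w A "\<lambda>_. V"])
      show "w x = w' x" if "x \<in> A" for x
        using that eq by (metis DiffI Pair_inject restrict_apply)
    qed (use w S in auto)
  qed
  have "card S \<le> card (Sigma T F)"
    by (rule card_inj_on_le[OF inj]) (use T_in F_in F T in auto)
  also have "\<dots> = (\<Sum>u\<in>T. card (F u))" using T F by simp
  also have "\<dots> \<le> card T * b" using F sum_bounded_above[of T "\<lambda>u. card (F u)" b] by simp
  finally show ?thesis .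
qed

lemma card_PiE_restrict_ge:
  fixes U :: "('i \<Rightarrow> 'a) set"
  assumes U: "U \<subseteq> I \<rightarrow>\<^sub>E V" and I: "I \<subseteq> A" and A: "finite A" and V: "finite V"
  shows "card U * card V ^ card (A - I) \<le> card {w \<in> A \<rightarrow>\<^sub>E V. restrict w I \<in> U}"
proof -
  define \<phi> :: "('i \<Rightarrow> 'a) \<times> ('i \<Rightarrow> 'a) \<Rightarrow> 'i \<Rightarrow> 'a"
    where "\<phi> = (\<lambda>(u, r) x. if x \<in> I then u x else r x)"
  have fst: "restrict (\<phi> (u, r)) I = u" if "u \<in> U" for u r
    using that U by (auto simp: \<phi>_def fun_eq_iff PiE_def extensional_def subset_iff)
  have snd: "restrict (\<phi> (u, r)) (A - I) = r" if "r \<in> (A - I) \<rightarrow>\<^sub>E V" for u r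
    using that by (auto simp: \<phi>_def fun_eq_iff PiE_def extensional_def)
  have inj: "inj_on \<phi> (U \<times> ((A - I) \<rightarrow>\<^sub>E V))"
    by (rule inj_onI) (metis (no_types, lifting) SigmaE fst snd)
  have "card U * card V ^ card (A - I) = card (U \<times> ((A - I) \<rightarrow>\<^sub>E V))"
    using A by (simp add: card_cartesian_product card_PiE)
  also have "\<dots> \<le> card {w \<in> A \<rightarrow>\<^sub>E V. restrict w I \<in> U}"
  proof (rule card_inj_on_le[OF inj])
    show "finite {w \<in> A \<rightarrow>\<^sub>E V. restrict w I \<in> U}"
      using A V by (simp add: finite_PiE)
    have "\<phi> (u, r) \<in> A \<rightarrow>\<^sub>E V" if "u \<in> U" "r \<in> (A - I) \<rightarrow>\<^sub>E V" for u r
      using that U I by (auto simp: \<phi>_def PiE_def extensional_def subset_iff Pi_def)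
    then show "\<phi> ` (U \<times> ((A - I) \<rightarrow>\<^sub>E V)) \<subseteq> {w \<in> A \<rightarrow>\<^sub>E V. restrict w I \<in> U}"
      using fst by auto
  qed
  finally show ?thesis .
qed

section \<open>Counting placements of one edge and of pairs of edges\<close>

lemma uniform_hypergraph_finite_edges:
  assumes "uniform_hypergraph k H" shows "finite (hedges H)"
  using assms by (auto simp: uniform_hypergraph_def intro: finite_subset[of _ "Pow (hverts H)"])

lemma hdeg_le_max_deg:
  assumes "finite (hverts H)" "S \<subseteq> hverts H"
  shows "hdeg H S \<le> max_deg (card S) H"
proof -
  have "{hdeg H S' | S'. S' \<subseteq> hverts H \<and> card S' = card S} \<subseteq> hdeg H ` Pow (hverts H)" by auto
  then have "finite {hdeg H S' | S'. S' \<subseteq> hverts H \<and> card S' = card S}"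
    using assms(1) by (meson finite_Pow_iff finite_imageI finite_subset)
  then show ?thesis unfolding max_deg_def by (rule Max_ge) (use assms in auto)
qed

text \<open>One bijection from \<open>I\<close> per edge is enough, since the image recovers the
  edge. The factor \<open>k!\<close> given away affects only the final constant.\<close>

lemma card_edge_embeddings_ge:
  assumes H: "uniform_hypergraph k H" and I: "finite I" "card I = k"
  shows "num_edges H \<le> card {u \<in> I \<rightarrow>\<^sub>E hverts H. u ` I \<in> hedges H}"
proof -
  have "\<exists>u. u \<in> I \<rightarrow>\<^sub>E hverts H \<and> u ` I = e" if "e \<in> hedges H" for e
  proof -
    have e: "e \<subseteq> hverts H" "card e = k" "finite e"
      using that H by (auto simp: uniform_hypergraph_def intro: finite_subset)
    then obtain g where "bij_betw g I e" using finite_same_card_bij I by metis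
    then have "restrict g I \<in> I \<rightarrow>\<^sub>E hverts H \<and> restrict g I ` I = e"
      using e by (auto simp: bij_betw_def)
    then show ?thesis by blast
  qed
  then obtain g where g: "\<And>e. e \<in> hedges H \<Longrightarrow> g e \<in> I \<rightarrow>\<^sub>E hverts H \<and> g e ` I = e" by metis
  have "inj_on g (hedges H)" using g by (metis inj_onI)
  then show ?thesis unfolding num_edges_def
    by (rule card_inj_on_le)
       (use g H I in \<open>auto simp: uniform_hypergraph_def finite_PiE\<close>)
qed

lemma card_edge_embeddings_le:
  assumes H: "uniform_hypergraph k H" and I: "finite I" "card I = k"
  shows "card {u \<in> I \<rightarrow>\<^sub>E hverts H. u ` I \<in> hedges H} \<le> num_edges H * k ^ k"
proof -
  have fin: "finite e" "card e = k" if "e \<in> hedges H" for e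
    using that H by (auto simp: uniform_hypergraph_def intro: finite_subset)
  have "{u \<in> I \<rightarrow>\<^sub>E hverts H. u ` I \<in> hedges H} \<subseteq> (\<Union>e\<in>hedges H. I \<rightarrow>\<^sub>E e)"
    by (auto simp: PiE_def)
  then have "card {u \<in> I \<rightarrow>\<^sub>E hverts H. u ` I \<in> hedges H} \<le> card (\<Union>e\<in>hedges H. I \<rightarrow>\<^sub>E e)"
    by (rule card_mono[rotated])
       (use uniform_hypergraph_finite_edges[OF H] I fin in \<open>auto intro!: finite_PiE\<close>)
  also have "\<dots> \<le> (\<Sum>e\<in>hedges H. card (I \<rightarrow>\<^sub>E e))"
    by (rule card_UN_le) (rule uniform_hypergraph_finite_edges[OF H])
  also have "\<dots> = num_edges H * k ^ k"
    using I fin by (simp add: card_PiE num_edges_def)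
  finally show ?thesis .
qed

lemma card_edge_placements_ge:
  assumes H: "uniform_hypergraph k H" and A: "finite A" and I: "I \<subseteq> A" "card I = k"
  shows "num_edges H * num_verts H ^ (card A - k) \<le> card {w \<in> A \<rightarrow>\<^sub>E hverts H. w ` I \<in> hedges H}"
proof -
  have fI: "finite I" using I A finite_subset by blast
  have V: "finite (hverts H)" using H by (simp add: uniform_hypergraph_def)
  let ?U = "{u \<in> I \<rightarrow>\<^sub>E hverts H. u ` I \<in> hedges H}"
  have "num_edges H * num_verts H ^ (card A - k) \<le> card ?U * card (hverts H) ^ card (A - I)"
    using card_edge_embeddings_ge[OF H fI I(2)] I fI by (simp add: num_verts_def card_Diff_subset)
  also have "\<dots> \<le> card {w \<in> A \<rightarrow>\<^sub>E hverts H. restrict w I \<in> ?U}"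
    by (rule card_PiE_restrict_ge) (use I A V in auto)
  also have "\<dots> \<le> card {w \<in> A \<rightarrow>\<^sub>E hverts H. w ` I \<in> hedges H}"
    by (rule card_mono) (use A V in \<open>auto simp: finite_PiE\<close>)
  finally show ?thesis .
qed

text \<open>Place the first edge on \<open>I\<close>. The second must contain the image of
  \<open>I \<inter> J\<close>, which leaves at most a degree's worth of candidates;
  \<open>J - I\<close> maps into the candidate, and all other indices are free.\<close>

lemma card_edge_pair_placements_le:
  assumes H: "uniform_hypergraph k H" and A: "finite A"
    and I: "I \<subseteq> A" "card I = k" and J: "J \<subseteq> A" "card J = k"
  shows "card {w \<in> A \<rightarrow>\<^sub>E hverts H. w ` I \<in> hedges H \<and> w ` J \<in> hedges H}
    \<le> num_edges H * k ^ k *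
        (max_deg (card (I \<inter> J)) H * k ^ (k - card (I \<inter> J)) * num_verts H ^ card (A - (I \<union> J)))"
    (is "card ?S \<le> _ * ?b")
proof -
  have fI: "finite I" "finite J" using I J A finite_subset by blast+
  have V: "finite (hverts H)" using H by (simp add: uniform_hypergraph_def)
  have fin: "finite e" "card e = k" if "e \<in> hedges H" for e
    using that H by (auto simp: uniform_hypergraph_def intro: finite_subset)
  define T where "T = {u \<in> I \<rightarrow>\<^sub>E hverts H. u ` I \<in> hedges H}"
  define N where "N = (\<lambda>u. {f \<in> hedges H. u ` (I \<inter> J) \<subseteq> f})"
  define F where
    "F = (\<lambda>u. {r \<in> (A - I) \<rightarrow>\<^sub>E hverts H. \<exists>f \<in> N u. restrict r (J - I) \<in> (J - I) \<rightarrow>\<^sub>E f})"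
  have F_le: "finite (F u) \<and> card (F u) \<le> ?b" if u: "u \<in> T" for u
  proof
    show "finite (F u)" unfolding F_def using A V by (simp add: finite_PiE)
    \<comment> \<open>The image has as many elements as \<open>I\<close>, which forces injectivity.
      So \<open>I \<inter> J\<close> keeps its size under \<open>u\<close>, and
      \<open>max_deg\<close> applies at that size.\<close>
    have "card (u ` I) = card I" using u fin I(2) by (auto simp: T_def)
    then have "inj_on u I" using fI by (simp add: eq_card_imp_inj_on)
    then have "card (u ` (I \<inter> J)) = card (I \<inter> J)" by (meson card_image inf_le1 inj_on_subset)
    moreover have "u ` (I \<inter> J) \<subseteq> hverts H" using u by (auto simp: T_def)
    ultimately have deg: "card (N u) \<le> max_deg (card (I \<inter> J)) H"
      using hdeg_le_max_deg[OF V, of "u ` (I \<inter> J)"] by (simp add: N_def hdeg_def)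
    have fN: "finite (N u)"
      unfolding N_def using uniform_hypergraph_finite_edges[OF H] by simp
    define T' where "T' = (\<Union>f \<in> N u. (J - I) \<rightarrow>\<^sub>E f)"
    have cJ: "card (J - I) = k - card (I \<inter> J)"
      using J fI by (metis Int_commute card_Diff_subset_Int finite_Int)
    have "card T' \<le> (\<Sum>f\<in>N u. card ((J - I) \<rightarrow>\<^sub>E f))"
      unfolding T'_def by (rule card_UN_le[OF fN])
    also have "\<dots> = card (N u) * k ^ (k - card (I \<inter> J))"
      using fI fin cJ by (simp add: card_PiE N_def)
    finally have T': "card T' \<le> max_deg (card (I \<inter> J)) H * k ^ (k - card (I \<inter> J))"
      using deg by (meson mult_le_mono1 order_trans)
    have D: "A - I - (J - I) = A - (I \<union> J)" by blast
    \<comment> \<open>The same fibre count again, now splitting \<open>A - I\<close> at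
      \<open>J - I\<close>: a map into some candidate edge, then arbitrary values.\<close>
    have "card (F u) \<le> card T' * num_verts H ^ card (A - (I \<union> J))"
    proof (rule card_PiE_le_fibres[of _ "A - I" "hverts H" _ "J - I"
            "\<lambda>_. (A - (I \<union> J)) \<rightarrow>\<^sub>E hverts H"])
      show "finite T'"
        unfolding T'_def using fN fin fI by (auto simp: N_def intro!: finite_PiE)
      show "finite ((A - (I \<union> J)) \<rightarrow>\<^sub>E hverts H) \<and>
          card ((A - (I \<union> J)) \<rightarrow>\<^sub>E hverts H) \<le> num_verts H ^ card (A - (I \<union> J))" for u
        using A V by (simp add: card_PiE finite_PiE num_verts_def)
    qed (use J D in \<open>auto simp: F_def T'_def\<close>)
    then show "card (F u) \<le> ?b" using T' by (meson mult_le_mono1 order_trans)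
  qed
  have "card ?S \<le> card T * ?b"
  proof (rule card_PiE_le_fibres[of _ A "hverts H" _ I F])
    show "finite T" unfolding T_def using fI V by (simp add: finite_PiE)
    show "restrict w I \<in> T" if "w \<in> ?S" for w
      using that I by (auto simp: T_def)
    show "restrict w (A - I) \<in> F (restrict w I)" if "w \<in> ?S" for w
    proof -
      have "w ` J \<in> N (restrict w I)" using that by (auto simp: N_def)
      moreover have "restrict (restrict w (A - I)) (J - I) \<in> (J - I) \<rightarrow>\<^sub>E w ` J"
        using J by (intro PiE_I) (auto simp: restrict_def)
      ultimately have "\<exists>f \<in> N (restrict w I). restrict (restrict w (A - I)) (J - I) \<in> (J - I) \<rightarrow>\<^sub>E f"
        by (rule bexI[rotated])
      moreover have "restrict w (A - I) \<in> (A - I) \<rightarrow>\<^sub>E hverts H" using that by auto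
      ultimately show ?thesis unfolding F_def by blast
    qed
  qed (use I F_le in auto)
  also have "\<dots> \<le> num_edges H * k ^ k * ?b"
    using card_edge_embeddings_le[OF H fI(1) I(2)] by (simp add: T_def)
  finally show ?thesis .
qed

text \<open>Group the sets \<open>J\<close> by \<open>S = I \<inter> J\<close>. As \<open>J\<close>
  is recovered from \<open>S\<close> and \<open>J - I\<close>, a group has at most
  \<open>M ^ (k - card S)\<close> members, and the weight makes every group total at most
  \<open>M ^ (k - 1)\<close>. There are fewer than \<open>2 ^ k\<close> nonempty
  \<open>S\<close>.\<close>

lemma sum_power_card_Int_le:
  fixes M :: nat
  assumes A: "finite A" "card A = M" and I: "I \<subseteq> A" "card I = k"
  shows "(\<Sum>J | J \<subseteq> A \<and> card J = k \<and> I \<inter> J \<noteq> {}. M ^ (card (I \<inter> J) - 1)) \<le> 2 ^ k * M ^ (k - 1)"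
proof -
  have fI: "finite I" using I A finite_subset by blast
  let ?\<J> = "{J. J \<subseteq> A \<and> card J = k \<and> I \<inter> J \<noteq> {}}"
  let ?P = "Pow I - {{}}"
  have f\<J>: "finite ?\<J>" using A by (auto intro: finite_subset[of _ "Pow A"])
  have "(\<Sum>J\<in>?\<J>. M ^ (card (I \<inter> J) - 1))
      = (\<Sum>S\<in>?P. \<Sum>J | J \<in> ?\<J> \<and> I \<inter> J = S. M ^ (card (I \<inter> J) - 1))"
    by (rule sum.group[symmetric]) (use f\<J> fI in auto)
  also have "\<dots> \<le> (\<Sum>S\<in>?P. M ^ (k - 1))"
  proof (rule sum_mono)
    fix S assume S: "S \<in> ?P"
    then have fS: "finite S" and cS: "1 \<le> card S" "card S \<le> k"
      using fI I card_mono[of I S] by (auto simp: Suc_le_eq card_gt_0_iff intro: finite_subset)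
    let ?B = "{T. T \<subseteq> A \<and> card T = k - card S}"
    have "card {J \<in> ?\<J>. I \<inter> J = S} \<le> card ?B"
    proof (rule card_inj_on_le)
      show "inj_on (\<lambda>J. J - I) {J \<in> ?\<J>. I \<inter> J = S}" by (rule inj_onI) blast
      show "(\<lambda>J. J - I) ` {J \<in> ?\<J>. I \<inter> J = S} \<subseteq> ?B"
        using fI by (auto simp: card_Diff_subset_Int Int_commute)
      show "finite ?B" using A by (auto intro: finite_subset[of _ "Pow A"])
    qed
    also have "\<dots> = M choose (k - card S)" using A by (simp add: n_subsets)
    also have "\<dots> \<le> M ^ (k - card S)"
      by (metis binomial_eq_0 binomial_le_pow le0 not_le)
    finally have "card {J \<in> ?\<J>. I \<inter> J = S} * M ^ (card S - 1) \<le> M ^ (k - card S) * M ^ (card S - 1)"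
      by simp
    also have "\<dots> = M ^ (k - 1)" using cS by (simp flip: power_add)
    finally show "(\<Sum>J | J \<in> ?\<J> \<and> I \<inter> J = S. M ^ (card (I \<inter> J) - 1)) \<le> M ^ (k - 1)"
      by simp
  qed
  also have "\<dots> \<le> 2 ^ k * M ^ (k - 1)"
    using fI I card_Diff_subset[of "{{}}" "Pow I"] by (simp add: card_Pow)
  finally show ?thesis .
qed

section \<open>Maker's attempts against a fixed strategy of Breaker\<close>

text \<open>Maker attempts the vertices \<open>w 0, w 1, \<dots>\<close> in turn. An attempt at an occupied vertex is
  dropped without a round being played, so only the number of attempts is known in advance.\<close>

primrec attempt_play ::
    "'a hypergraph \<Rightarrow> 'a breaker_strategy \<Rightarrow> (nat \<Rightarrow> 'a) \<Rightarrow> nat \<Rightarrow> 'a history" where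
  "attempt_play H \<sigma> w 0 = []"
| "attempt_play H \<sigma> w (Suc i) =
    (let h = attempt_play H \<sigma> w i in if w i \<in> free_verts H h then h @ [(w i, \<sigma> h (w i))] else h)"

lemma play_against_attempt_play: "play_against H \<sigma> (attempt_play H \<sigma> w i)"
  by (induction i) (auto simp: Let_def intro: play_against.intros)

text \<open>The position before attempt \<open>i\<close> does not depend on \<open>w i\<close>; this
  is the independence behind \<open>card_failed_attempt_le\<close>.\<close>

lemma attempt_play_cong:
  "(\<And>j. j < i \<Longrightarrow> w j = w' j) \<Longrightarrow> attempt_play H \<sigma> w i = attempt_play H \<sigma> w' i"
  by (induction i) (auto simp: Let_def)

lemma maker_set_attempt_play_mono:
  "i \<le> j \<Longrightarrow> maker_set (attempt_play H \<sigma> w i) \<subseteq> maker_set (attempt_play H \<sigma> w j)"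
  by (induction j rule: dec_induct) (auto simp: Let_def maker_set_def)

text \<open>An occupied vertex outside Breaker's set already belongs to Maker, so a repeated attempt
  does no harm.\<close>

lemma attempt_succeeds:
  assumes "w i \<in> hverts H" "w i \<notin> breaker_set (attempt_play H \<sigma> w i)" "i < M"
  shows "w i \<in> maker_set (attempt_play H \<sigma> w M)"
proof -
  have "w i \<in> maker_set (attempt_play H \<sigma> w (Suc i))"
    using assms(1,2) by (auto simp: Let_def maker_set_def free_verts_def)
  then show ?thesis using maker_set_attempt_play_mono[of "Suc i" M] assms(3) by (metis Suc_leI subsetD)
qed

lemma card_breaker_set_attempt_play:
  assumes "legal_breaker_strategy H q \<sigma>" "finite (hverts H)"
  shows "finite (breaker_set (attempt_play H \<sigma> w i)) \<and> card (breaker_set (attempt_play H \<sigma> w i)) \<le> q * i"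
proof (induction i)
  case 0
  then show ?case by (simp add: breaker_set_def)
next
  case (Suc i)
  define h where "h = attempt_play H \<sigma> w i"
  show ?case
  proof (cases "w i \<in> free_verts H h")
    case True
    have \<sigma>: "\<sigma> h (w i) \<subseteq> free_verts H h - {w i}" "card (\<sigma> h (w i)) \<le> q"
      using assms(1) play_against_attempt_play True
      unfolding legal_breaker_strategy_def h_def by blast+
    then have "finite (\<sigma> h (w i))"
      using assms(2) by (auto simp: free_verts_def intro: finite_subset[of _ "hverts H"])
    moreover have "breaker_set (attempt_play H \<sigma> w (Suc i)) = breaker_set h \<union> \<sigma> h (w i)"
      using True by (auto simp: breaker_set_def Let_def simp flip: h_def)
    moreover have "card (breaker_set h \<union> \<sigma> h (w i)) \<le> q * i + q"
      using card_Un_le[of "breaker_set h" "\<sigma> h (w i)"] Suc \<sigma>(2) by (simp add: h_def)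
    ultimately show ?thesis using Suc by (simp add: h_def)
  qed (use Suc in \<open>auto simp: h_def\<close>)
qed

text \<open>Fixing all attempts except \<open>i\<close> fixes the position before attempt
  \<open>i\<close>, in which Breaker owns at most \<open>q * i\<close> vertices. So at most
  \<open>q * M\<close> choices of \<open>w i\<close> fail.\<close>

lemma card_failed_attempt_le:
  assumes \<sigma>: "legal_breaker_strategy H q \<sigma>" and V: "finite (hverts H)" and i: "i < M"
  shows "card {w \<in> {..<M} \<rightarrow>\<^sub>E hverts H. w i \<in> breaker_set (attempt_play H \<sigma> w i)}
    \<le> num_verts H ^ (M - 1) * (q * M)" (is "card ?S \<le> _")
proof -
  let ?T = "({..<M} - {i}) \<rightarrow>\<^sub>E hverts H"
  \<comment> \<open>Erasing the value at \<open>i\<close> leaves the play before attempt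
    \<open>i\<close> intact, so the fibre can be read off the restriction.\<close>
  have cong: "attempt_play H \<sigma> (restrict w ({..<M} - {i})) i = attempt_play H \<sigma> w i" for w
    by (rule attempt_play_cong) (use i in auto)
  have D: "{..<M} - ({..<M} - {i}) = {i}" using i by auto
  have "card ?S \<le> card ?T * (q * M)"
  proof (rule card_PiE_le_fibres[of _ "{..<M}" "hverts H" _ "{..<M} - {i}"
          "\<lambda>u. {i} \<rightarrow>\<^sub>E breaker_set (attempt_play H \<sigma> u i)"])
    show "finite ?T" using V by (simp add: finite_PiE)
    have "q * i \<le> q * M" using i by simp
    then have "finite (breaker_set (attempt_play H \<sigma> u i)) \<and>
        card (breaker_set (attempt_play H \<sigma> u i)) \<le> q * M" for u
      using card_breaker_set_attempt_play[OF \<sigma> V, of u i] by linarith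
    then show "finite ({i} \<rightarrow>\<^sub>E breaker_set (attempt_play H \<sigma> u i)) \<and>
        card ({i} \<rightarrow>\<^sub>E breaker_set (attempt_play H \<sigma> u i)) \<le> q * M" for u
      by (simp add: card_PiE finite_PiE)
  qed (auto simp: cong D)
  also have "card ?T = num_verts H ^ (M - 1)"
    using i by (simp add: card_PiE num_verts_def)
  finally show ?thesis .
qed

section \<open>First and second moments of the number of index sets that spell an edge\<close>

lemma sum_card_filter_swap:
  assumes "finite A" "finite B"
  shows "(\<Sum>w\<in>A. card {I \<in> B. P w I}) = (\<Sum>I\<in>B. card {w \<in> A. P w I})"
proof -
  have "(\<Sum>w\<in>A. card {I \<in> B. P w I}) = (\<Sum>w\<in>A. \<Sum>I\<in>B. if P w I then 1 else 0)"
    using assms by (simp add: sum.If_cases Int_def)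
  also have "\<dots> = (\<Sum>I\<in>B. \<Sum>w\<in>A. if P w I then 1 else 0)" by (rule sum.swap)
  also have "\<dots> = (\<Sum>I\<in>B. card {w \<in> A. P w I})"
    using assms by (simp add: sum.If_cases Int_def)
  finally show ?thesis .
qed

abbreviation index_sets :: "nat \<Rightarrow> nat \<Rightarrow> nat set set" where
  "index_sets M k \<equiv> {I. I \<subseteq> {..<M} \<and> card I = k}"

lemma finite_index_sets: "finite (index_sets M k)"
  by (rule finite_subset[of _ "Pow {..<M}"]) auto

text \<open>First moment, with sums over all sequences in place of expectations, hence the factor
  \<open>num_verts H ^ M\<close>. There are at least \<open>(M / k) ^ k\<close> index sets.\<close>

lemma sum_edge_indices_ge:
  assumes H: "uniform_hypergraph k H" and M: "k \<le> M" and v: "num_verts H > 0"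
  shows "real (num_edges H) * (real M / real (num_verts H)) ^ k / real k ^ k * real (num_verts H) ^ M
    \<le> (\<Sum>w \<in> {..<M} \<rightarrow>\<^sub>E hverts H. real (card {I \<in> index_sets M k. w ` I \<in> hedges H}))"
proof -
  let ?\<Omega> = "{..<M} \<rightarrow>\<^sub>E hverts H"
  have V: "finite (hverts H)" using H by (simp add: uniform_hypergraph_def)
  then have \<Omega>: "finite ?\<Omega>" by (simp add: finite_PiE)
  have "real (num_edges H) * (real M / real (num_verts H)) ^ k / real k ^ k * real (num_verts H) ^ M
      = (real M / real k) ^ k * (real (num_edges H) * real (num_verts H) ^ (M - k))"
    using M v by (simp add: power_divide power_diff mult_ac)
  also have "\<dots> \<le> real (M choose k) * (real (num_edges H) * real (num_verts H) ^ (M - k))"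
    by (intro mult_right_mono binomial_ge_n_over_k_pow_k M) auto
  also have "\<dots> = real (\<Sum>I\<in>index_sets M k. num_edges H * num_verts H ^ (M - k))"
    by (simp add: n_subsets)
  also have "\<dots> \<le> real (\<Sum>I\<in>index_sets M k. card {w \<in> ?\<Omega>. w ` I \<in> hedges H})"
    using card_edge_placements_ge[OF H, of "{..<M}"]
    by (intro of_nat_mono sum_mono) auto
  also have "\<dots> = real (\<Sum>w\<in>?\<Omega>. card {I \<in> index_sets M k. w ` I \<in> hedges H})"
    by (rule arg_cong[OF sum_card_filter_swap[OF \<Omega> finite_index_sets, symmetric]])
  finally show ?thesis by simp
qed

text \<open>The hypothesis on \<open>max_deg\<close> has the shape that makes the power of
  \<open>num_verts H\<close> independent of the overlap. The overlap survives only in the power of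
  \<open>M\<close>, the weight summed in \<open>sum_power_card_Int_le\<close>.\<close>

lemma card_edge_pair_placements_le_power:
  fixes C :: real
  assumes H: "uniform_hypergraph k H" and v: "num_verts H > 0"
    and deg: "\<And>l. l \<in> {1..k} \<Longrightarrow>
      real (max_deg l H) \<le> C * density H * (real M / real (num_verts H)) ^ (l - 1)"
    and I: "I \<in> index_sets M k" and J: "J \<in> index_sets M k" and IJ: "I \<inter> J \<noteq> {}"
  shows "real (card {w \<in> {..<M} \<rightarrow>\<^sub>E hverts H. w ` I \<in> hedges H \<and> w ` J \<in> hedges H})
    \<le> C * real k ^ (2 * k) * real (num_edges H) ^ 2 * real (num_verts H) ^ M / real (num_verts H) ^ (2 * k)
       * real M ^ (card (I \<inter> J) - 1)"
proof -
  define l where "l = card (I \<inter> J)"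
  define n where "n = real (num_verts H)"
  define e where "e = real (num_edges H)"
  have n: "n > 0" using v by (simp add: n_def)
  have fIJ: "finite I" "finite J" using I J by (auto intro: finite_subset)
  have l1: "1 \<le> l" using IJ fIJ by (simp add: l_def Suc_le_eq card_gt_0_iff)
  have lk: "l \<le> k" using I fIJ card_mono[of I "I \<inter> J"] by (auto simp: l_def)
  have cU: "card (I \<union> J) = 2 * k - l"
    using card_Un_Int[OF fIJ] I J by (simp add: l_def)
  \<comment> \<open>Keeps the natural subtraction in the exponent \<open>M - (2 * k - l)\<close>
    exact.\<close>
  have UM: "2 * k - l \<le> M"
    using card_mono[of "{..<M}" "I \<union> J"] I J cU by auto
  have cD: "card ({..<M} - (I \<union> J)) = M - (2 * k - l)"
    using I J fIJ cU by (subst card_Diff_subset) auto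
  have k1: "k \<ge> 1" using l1 lk by simp
  have "real (card {w \<in> {..<M} \<rightarrow>\<^sub>E hverts H. w ` I \<in> hedges H \<and> w ` J \<in> hedges H})
    \<le> real (num_edges H * k ^ k * (max_deg l H * k ^ (k - l) * num_verts H ^ (M - (2 * k - l))))"
    using card_edge_pair_placements_le[OF H, of "{..<M}" I J] I J cD
    by (intro of_nat_mono) (auto simp: l_def)
  also have "\<dots> = e * real k ^ k * (real (max_deg l H) * real k ^ (k - l) * n ^ (M - (2 * k - l)))"
    by (simp add: e_def n_def)
  also have "\<dots> \<le> e * real k ^ k * (C * density H * (real M / n) ^ (l - 1) * real k ^ k * n ^ (M - (2 * k - l)))"
  proof -
    have "real (max_deg l H) \<le> C * density H * (real M / n) ^ (l - 1)"
      using deg[of l] l1 lk by (simp add: n_def)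
    moreover have "real k ^ (k - l) \<le> real k ^ k" using k1 by (intro power_increasing) auto
    ultimately have "real (max_deg l H) * real k ^ (k - l)
        \<le> C * density H * (real M / n) ^ (l - 1) * real k ^ k"
      by (rule mult_mono') auto
    then show ?thesis using n by (intro mult_left_mono mult_right_mono) (auto simp: e_def)
  qed
  also have "\<dots> = C * real k ^ (2 * k) * e ^ 2 * n ^ M / n ^ (2 * k) * real M ^ (l - 1)"
  proof -
    \<comment> \<open>The factors belong, in order, to the indices covered by the two edges, to the
      degree bound, and to the denominator of \<open>density H\<close>.\<close>
    have "n ^ (2 * k) = n ^ (2 * k - l) * n ^ (l - 1) * n"
      using l1 lk by (simp flip: power_add power_Suc2)
    moreover have "n ^ (M - (2 * k - l)) = n ^ M / n ^ (2 * k - l)"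
      using n UM by (simp add: power_diff)
    moreover have "real k ^ (2 * k) = real k ^ k * real k ^ k" by (simp add: mult_2 power_add)
    ultimately show ?thesis
      by (simp add: density_def e_def[symmetric] n_def[symmetric] power_divide power2_eq_square
          mult_ac)
  qed
  finally show ?thesis by (simp add: l_def n_def e_def)
qed

text \<open>A square counts ordered pairs of index sets that both contain \<open>i\<close>. Summing
  over \<open>i\<close> weights a pair by \<open>card (I \<inter> J) \<le> k\<close>, so disjoint
  pairs vanish. At most \<open>M ^ k\<close> choices of \<open>I\<close> and
  \<open>M ^ (k - 1)\<close> from the overlaps give \<open>M ^ (2 * k) / M\<close>.\<close>

lemma sum_edge_indices_square_le:
  fixes C :: real
  assumes H: "uniform_hypergraph k H" and v: "num_verts H > 0" and k: "k \<ge> 1" and M: "M > 0" and C: "C \<ge> 0"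
    and deg: "\<And>l. l \<in> {1..k} \<Longrightarrow>
      real (max_deg l H) \<le> C * density H * (real M / real (num_verts H)) ^ (l - 1)"
  shows "(\<Sum>w \<in> {..<M} \<rightarrow>\<^sub>E hverts H. \<Sum>i<M.
      real (card {I \<in> index_sets M k. i \<in> I \<and> w ` I \<in> hedges H}) ^ 2)
    \<le> real (k * 2 ^ k * k ^ (2 * k)) * C *
       (real (num_edges H) * (real M / real (num_verts H)) ^ k) ^ 2 / real M * real (num_verts H) ^ M"
proof -
  let ?\<Omega> = "{..<M} \<rightarrow>\<^sub>E hverts H"
  let ?E = "hedges H"
  let ?\<I> = "index_sets M k"
  define \<kappa> where "\<kappa> = C * real k ^ (2 * k) * real (num_edges H) ^ 2 * real (num_verts H) ^ M / real (num_verts H) ^ (2 * k)"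
  have \<kappa>: "\<kappa> \<ge> 0" using C by (simp add: \<kappa>_def)
  have V: "finite (hverts H)" using H by (simp add: uniform_hypergraph_def)
  then have \<Omega>: "finite ?\<Omega>" by (simp add: finite_PiE)
  define g where "g = (\<lambda>I J. card {w \<in> ?\<Omega>. w ` I \<in> ?E \<and> w ` J \<in> ?E})"
  define P where "P = (\<lambda>(w :: nat \<Rightarrow> 'a) i (I, J). i \<in> I \<inter> J \<and> w ` I \<in> ?E \<and> w ` J \<in> ?E)"
  have sq: "card {I \<in> ?\<I>. i \<in> I \<and> w ` I \<in> ?E} ^ 2 = card {p \<in> ?\<I> \<times> ?\<I>. P w i p}" for w :: "nat \<Rightarrow> 'a" and i
  proof -
    have "{p \<in> ?\<I> \<times> ?\<I>. P w i p} = {I \<in> ?\<I>. i \<in> I \<and> w ` I \<in> ?E} \<times> {I \<in> ?\<I>. i \<in> I \<and> w ` I \<in> ?E}"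
      by (auto simp: P_def)
    then show ?thesis by (simp add: card_cartesian_product power2_eq_square)
  qed
  have fin2: "finite (?\<I> \<times> ?\<I>)" using finite_index_sets by simp
  have "(\<Sum>w\<in>?\<Omega>. \<Sum>i<M. card {I \<in> ?\<I>. i \<in> I \<and> w ` I \<in> ?E} ^ 2)
      = (\<Sum>w\<in>?\<Omega>. \<Sum>i<M. card {p \<in> ?\<I> \<times> ?\<I>. P w i p})"
    by (simp only: sq)
  also have "\<dots> = (\<Sum>(w, i) \<in> ?\<Omega> \<times> {..<M}. card {p \<in> ?\<I> \<times> ?\<I>. P w i p})"
    by (simp only: sum.cartesian_product)
  also have "\<dots> = (\<Sum>p \<in> ?\<I> \<times> ?\<I>. card {x \<in> ?\<Omega> \<times> {..<M}. P (fst x) (snd x) p})"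
    using sum_card_filter_swap[OF _ fin2, of "?\<Omega> \<times> {..<M}" "\<lambda>x. P (fst x) (snd x)"] \<Omega>
    by (simp add: case_prod_unfold)
  also have "\<dots> = (\<Sum>(I, J) \<in> ?\<I> \<times> ?\<I>. card (I \<inter> J) * g I J)"
  proof (rule sum.cong[OF refl], clarify)
    fix I J assume "I \<subseteq> {..<M}" "J \<subseteq> {..<M}"
    then have "{x \<in> ?\<Omega> \<times> {..<M}. P (fst x) (snd x) (I, J)}
        = {w \<in> ?\<Omega>. w ` I \<in> ?E \<and> w ` J \<in> ?E} \<times> (I \<inter> J)"
      by (auto simp: P_def)
    then show "card {x \<in> ?\<Omega> \<times> {..<M}. P (fst x) (snd x) (I, J)} = card (I \<inter> J) * g I J"
      by (simp add: card_cartesian_product g_def)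
  qed
  also have "\<dots> = (\<Sum>I\<in>?\<I>. \<Sum>J\<in>?\<I>. card (I \<inter> J) * g I J)"
    by (simp only: sum.cartesian_product)
  finally have eq: "(\<Sum>w\<in>?\<Omega>. \<Sum>i<M. card {I \<in> ?\<I>. i \<in> I \<and> w ` I \<in> ?E} ^ 2)
      = (\<Sum>I\<in>?\<I>. \<Sum>J\<in>?\<I>. card (I \<inter> J) * g I J)" .
  have inner: "(\<Sum>J\<in>?\<I>. real (card (I \<inter> J) * g I J)) \<le> real k * \<kappa> * (2 ^ k * real M ^ (k - 1))"
    if I: "I \<in> ?\<I>" for I
  proof -
    let ?\<J> = "{J. J \<subseteq> {..<M} \<and> card J = k \<and> I \<inter> J \<noteq> {}}"
    have fI: "finite I" using I by (auto intro: finite_subset)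
    have "(\<Sum>J\<in>?\<I>. real (card (I \<inter> J) * g I J)) = (\<Sum>J\<in>?\<J>. real (card (I \<inter> J) * g I J))"
      by (rule sum.mono_neutral_right[OF finite_index_sets]) auto
    also have "\<dots> \<le> (\<Sum>J\<in>?\<J>. real k * (\<kappa> * real M ^ (card (I \<inter> J) - 1)))"
    proof (rule sum_mono)
      fix J assume J: "J \<in> ?\<J>"
      have "card (I \<inter> J) \<le> k" using I fI card_mono[of I "I \<inter> J"] by auto
      moreover have "real (g I J) \<le> \<kappa> * real M ^ (card (I \<inter> J) - 1)"
        unfolding g_def \<kappa>_def
        by (rule card_edge_pair_placements_le_power[OF H v deg I]) (use J in auto)
      ultimately show "real (card (I \<inter> J) * g I J) \<le> real k * (\<kappa> * real M ^ (card (I \<inter> J) - 1))"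
        unfolding of_nat_mult by (intro mult_mono) auto
    qed
    also have "\<dots> = real k * \<kappa> * real (\<Sum>J\<in>?\<J>. M ^ (card (I \<inter> J) - 1))"
      by (simp add: sum_distrib_left mult.assoc)
    also have "\<dots> \<le> real k * \<kappa> * real (2 ^ k * M ^ (k - 1))"
      using sum_power_card_Int_le[of "{..<M}" M I k] I \<kappa>
      by (intro mult_left_mono of_nat_mono) auto
    finally show ?thesis by simp
  qed
  have "(\<Sum>w\<in>?\<Omega>. \<Sum>i<M. real (card {I \<in> ?\<I>. i \<in> I \<and> w ` I \<in> ?E}) ^ 2)
      = (\<Sum>I\<in>?\<I>. \<Sum>J\<in>?\<I>. real (card (I \<inter> J) * g I J))"
    using arg_cong[OF eq, of real] by simp
  also have "\<dots> \<le> (\<Sum>I\<in>?\<I>. real k * \<kappa> * (2 ^ k * real M ^ (k - 1)))"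
    by (rule sum_mono) (rule inner)
  also have "\<dots> = real (M choose k) * (real k * \<kappa> * (2 ^ k * real M ^ (k - 1)))"
    by (simp add: n_subsets)
  also have "\<dots> \<le> real (M ^ k) * (real k * \<kappa> * (2 ^ k * real M ^ (k - 1)))"
  proof -
    have "M choose k \<le> M ^ k" by (metis binomial_eq_0 binomial_le_pow le0 not_le)
    then show ?thesis using \<kappa> by (intro mult_right_mono of_nat_mono) auto
  qed
  also have "\<dots> = real (k * 2 ^ k * k ^ (2 * k)) * C *
       (real (num_edges H) * (real M / real (num_verts H)) ^ k) ^ 2 / real M * real (num_verts H) ^ M"
  proof -
    have "real M ^ k = real M ^ (k - 1) * real M" using k by (simp flip: power_Suc2)
    then show ?thesis
      using M by (simp add: \<kappa>_def power_divide power_mult_distrib power_mult power2_eq_square mult_2 power_add)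
  qed
  finally show ?thesis .
qed

section \<open>Beating a fixed strategy of Breaker\<close>

text \<open>Weighted AM-GM; summed with a suitable \<open>\<rho>\<close> it acts as Cauchy-Schwarz
  without square roots.\<close>

lemma real_prod_le_weighted_squares:
  fixes a b \<rho> :: real
  assumes "\<rho> > 0"
  shows "a * b \<le> \<rho> / 2 * a\<^sup>2 + b\<^sup>2 / (2 * \<rho>)"
proof -
  have "2 * \<rho> * (a * b) \<le> 2 * \<rho> * (\<rho> / 2 * a\<^sup>2 + b\<^sup>2 / (2 * \<rho>))"
    using assms sum_squares_bound[of "\<rho> * a" b] by (simp add: distrib_left power2_eq_square mult_ac)
  then show ?thesis using assms by simp
qed

text \<open>Two demands on \<open>M\<close> are balanced: \<open>deg\<close> asks for many attempts,
  to control the second moment, and \<open>qM\<close> for few, so that Breaker holds at most a share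
  \<open>\<delta>\<close> of the vertices.\<close>

lemma not_breaker_wins:
  fixes C \<delta> :: real
  assumes H: "uniform_hypergraph k H" and edges: "hedges H \<noteq> {}" and k: "k \<ge> 1" and M: "k \<le> M"
    and C: "C > 0"
    and deg: "\<And>l. l \<in> {1..k} \<Longrightarrow>
      real (max_deg l H) \<le> C * density H * (real M / real (num_verts H)) ^ (l - 1)"
    and qM: "real q * real M \<le> \<delta> * real (num_verts H)"
    and \<delta>: "\<delta> * (real (k * 2 ^ k * k ^ (2 * k)) * C * real k ^ (2 * k)) < 1"
  shows "\<not> breaker_wins H q"
proof
  assume "breaker_wins H q"
  then obtain \<sigma> where \<sigma>: "legal_breaker_strategy H q \<sigma>"
    and lost: "\<And>h. play_against H \<sigma> h \<Longrightarrow> \<not> maker_has_won H h"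
    unfolding breaker_wins_def by blast
  let ?\<Omega> = "{..<M} \<rightarrow>\<^sub>E hverts H"
  have V: "finite (hverts H)" using H by (simp add: uniform_hypergraph_def)
  then have \<Omega>: "finite ?\<Omega>" by (simp add: finite_PiE)
  have e0: "num_edges H > 0"
    using edges uniform_hypergraph_finite_edges[OF H] by (simp add: num_edges_def card_gt_0_iff)
  obtain e where "e \<in> hedges H" using edges by blast
  then have "e \<noteq> {}" "e \<subseteq> hverts H" using H k by (auto simp: uniform_hypergraph_def)
  then have v0: "num_verts H > 0" using V by (auto simp: num_verts_def card_gt_0_iff)
  have M0: "M > 0" using M k by simp
  define v where "v = real (num_verts H)"
  define Y where "Y = real (num_edges H) * (real M / v) ^ k"
  define K where "K = real (k * 2 ^ k * k ^ (2 * k)) * C"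
  \<comment> \<open>Makes the second-moment term \<open>K / (2 * t)\<close> below exactly half of
    the lower bound \<open>1 / k ^ k\<close>. The factor \<open>Y / M\<close> in
    \<open>\<rho>\<close> is the scale of \<open>D\<close>.\<close>
  define t where "t = K * real k ^ k"
  define \<rho> where "\<rho> = t * Y / real M"
  have v: "v > 0" using v0 by (simp add: v_def)
  have Y: "Y > 0" using e0 v M0 by (simp add: Y_def)
  have K: "K > 0" using k C by (simp add: K_def)
  have t: "t > 0" using K k by (simp add: t_def)
  have \<rho>: "\<rho> > 0" using t Y M0 by (simp add: \<rho>_def)
  define bad where "bad = (\<lambda>w i. w i \<in> breaker_set (attempt_play H \<sigma> w i))"
  define D where "D = (\<lambda>w i. real (card {I \<in> index_sets M k. i \<in> I \<and> w ` I \<in> hedges H}))"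
  have X_le: "real (card {I \<in> index_sets M k. w ` I \<in> hedges H}) \<le> (\<Sum>i<M. of_bool (bad w i) * D w i)"
    if w: "w \<in> ?\<Omega>" for w
  proof -
    \<comment> \<open>If no attempt in \<open>I\<close> failed, Maker would own the edge that
      \<open>I\<close> spells, against \<open>lost\<close>.\<close>
    have hit: "\<exists>i\<in>I. bad w i" if I: "I \<subseteq> {..<M}" "w ` I \<in> hedges H" for I
    proof (rule ccontr)
      assume "\<not> (\<exists>i\<in>I. bad w i)"
      then have "w i \<in> maker_set (attempt_play H \<sigma> w M)" if "i \<in> I" for i
        using that I w attempt_succeeds[of w i H \<sigma> M] by (auto simp: bad_def)
      then have "maker_has_won H (attempt_play H \<sigma> w M)"
        using I(2) unfolding maker_has_won_def by blast
      then show False using lost play_against_attempt_play by blast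
    qed
    have "{I \<in> index_sets M k. w ` I \<in> hedges H}
        \<subseteq> (\<Union>i \<in> {i. i < M \<and> bad w i}. {I \<in> index_sets M k. i \<in> I \<and> w ` I \<in> hedges H})"
    proof
      fix I assume I: "I \<in> {I \<in> index_sets M k. w ` I \<in> hedges H}"
      then obtain i where "i \<in> I" "bad w i" using hit[of I] by auto
      moreover from this have "i < M" using I by auto
      ultimately show "I \<in> (\<Union>i \<in> {i. i < M \<and> bad w i}.
          {I \<in> index_sets M k. i \<in> I \<and> w ` I \<in> hedges H})"
        using I by blast
    qed
    then have "card {I \<in> index_sets M k. w ` I \<in> hedges H}
        \<le> card (\<Union>i \<in> {i. i < M \<and> bad w i}. {I \<in> index_sets M k. i \<in> I \<and> w ` I \<in> hedges H})"
      by (rule card_mono[rotated]) (use finite_index_sets[of M k] in auto)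
    also have "\<dots> \<le> (\<Sum>i \<in> {i. i < M \<and> bad w i}. card {I \<in> index_sets M k. i \<in> I \<and> w ` I \<in> hedges H})"
      by (rule card_UN_le) simp
    finally have "real (card {I \<in> index_sets M k. w ` I \<in> hedges H})
        \<le> (\<Sum>i \<in> {i. i < M \<and> bad w i}. D w i)"
      unfolding D_def of_nat_sum[symmetric] by (rule of_nat_mono)
    also have "\<dots> = (\<Sum>i<M. of_bool (bad w i) * D w i)"
      by (rule sum.mono_neutral_cong_left) auto
    finally show ?thesis .
  qed
  have bad_le: "(\<Sum>w\<in>?\<Omega>. \<Sum>i<M. of_bool (bad w i) ^ 2) \<le> real M * (v ^ M * \<delta>)"
  proof -
    have "(\<Sum>w\<in>?\<Omega>. \<Sum>i<M. (of_bool (bad w i) :: real) ^ 2) = (\<Sum>i<M. \<Sum>w\<in>?\<Omega>. of_bool (bad w i))"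
      by (subst sum.swap) (simp add: power2_eq_square flip: of_bool_conj)
    also have "\<dots> = (\<Sum>i<M. real (card {w \<in> ?\<Omega>. bad w i}))"
      using \<Omega> by (simp add: sum.If_cases Int_def of_bool_def)
    also have "\<dots> \<le> (\<Sum>i<M. v ^ M * \<delta>)"
    proof (rule sum_mono)
      fix i assume i: "i \<in> {..<M}"
      have "real (card {w \<in> ?\<Omega>. bad w i}) \<le> real (num_verts H ^ (M - 1) * (q * M))"
        unfolding bad_def by (intro of_nat_mono card_failed_attempt_le \<sigma> V) (use i in auto)
      also have "\<dots> = v ^ (M - 1) * (real q * real M)" by (simp add: v_def)
      also have "\<dots> \<le> v ^ (M - 1) * (\<delta> * v)"
        using qM v by (intro mult_left_mono) (auto simp: v_def)
      also have "\<dots> = v ^ M * \<delta>" using M0 by (simp add: power_eq_if)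
      finally show "real (card {w \<in> ?\<Omega>. bad w i}) \<le> v ^ M * \<delta>" .
    qed
    finally show ?thesis by simp
  qed
  have D_le: "(\<Sum>w\<in>?\<Omega>. \<Sum>i<M. D w i ^ 2) \<le> K * Y ^ 2 / real M * v ^ M"
    using sum_edge_indices_square_le[OF H v0 k M0 _ deg] C
    unfolding D_def K_def Y_def v_def by simp
  have "Y / real k ^ k * v ^ M
      \<le> (\<Sum>w\<in>?\<Omega>. real (card {I \<in> index_sets M k. w ` I \<in> hedges H}))"
    using sum_edge_indices_ge[OF H M v0] by (simp add: Y_def v_def)
  also have "\<dots> \<le> (\<Sum>w\<in>?\<Omega>. \<Sum>i<M. of_bool (bad w i) * D w i)"
    by (rule sum_mono) (rule X_le)
  \<comment> \<open>Failures and the counts \<open>D\<close> depend on each other; the inequality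
    separates them into two sums that are bounded on their own.\<close>
  also have "\<dots> \<le> (\<Sum>w\<in>?\<Omega>. \<Sum>i<M. \<rho> / 2 * of_bool (bad w i) ^ 2 + D w i ^ 2 / (2 * \<rho>))"
    by (intro sum_mono real_prod_le_weighted_squares \<rho>)
  also have "\<dots> = \<rho> / 2 * (\<Sum>w\<in>?\<Omega>. \<Sum>i<M. of_bool (bad w i) ^ 2)
      + (\<Sum>w\<in>?\<Omega>. \<Sum>i<M. D w i ^ 2) / (2 * \<rho>)"
    by (simp only: sum.distrib sum_distrib_left sum_divide_distrib)
  also have "\<dots> \<le> \<rho> / 2 * (real M * (v ^ M * \<delta>)) + (K * Y ^ 2 / real M * v ^ M) / (2 * \<rho>)"
    using \<rho> by (intro add_mono mult_left_mono divide_right_mono bad_le D_le) auto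
  also have "\<dots> = (t * \<delta> / 2 + K / (2 * t)) * (Y * v ^ M)"
    using M0 Y t by (simp add: \<rho>_def field_simps power2_eq_square)
  finally have "1 / real k ^ k * (Y * v ^ M) \<le> (t * \<delta> / 2 + K / (2 * t)) * (Y * v ^ M)" by simp
  then have "1 / real k ^ k \<le> t * \<delta> / 2 + K / (2 * t)"
    by (rule mult_right_le_imp_le) (use Y v in simp)
  moreover have "K / (2 * t) = 1 / real k ^ k / 2" using K by (simp add: t_def)
  ultimately have "1 / real k ^ k \<le> t * \<delta>" by simp
  then have "1 \<le> t * \<delta> * real k ^ k" using k by (simp add: divide_le_eq)
  also have "\<dots> = \<delta> * (K * real k ^ (2 * k))" by (simp add: t_def mult_2 power_add)
  finally have "1 \<le> \<delta> * (K * real k ^ (2 * k))" .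
  then show False using \<delta> by (simp add: K_def)
qed

section \<open>Choice of the constants and of the number of attempts\<close>

theorem theorem1p2:
  fixes k :: nat and H :: "nat \<Rightarrow> 'a hypergraph"
  assumes k: "k \<ge> 2"
    and uniform: "\<And>n. uniform_hypergraph k (H n)"
    and M1: "(\<lambda>n. real (max_deg 1 (H n))) \<in> O(\<lambda>n. density (H n))"
    and M2: "(\<lambda>n. real (max_deg 2 (H n))) \<in> o(\<lambda>n. density (H n))"
    and M3: "(\<lambda>n. density (H n)) \<in> o(\<lambda>n. real (num_verts (H n)) ^ (k - 1))"
  shows "(\<lambda>n. real (threshold_bias (H n))) \<in>
    \<Omega>(\<lambda>n. MIN l\<in>{2..k}. (density (H n) / real (max_deg l (H n))) powr (1 / (real l - 1)))"
proof -
  have d0: "density (H n) \<ge> 0" for n by (simp add: density_def)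
  define \<mu> where "\<mu> = (\<lambda>n. MIN l\<in>{2..k}. (density (H n) / real (max_deg l (H n))) powr (1 / (real l - 1)))"
  have \<mu>_in: "\<mu> n \<in> (\<lambda>l. (density (H n) / real (max_deg l (H n))) powr (1 / (real l - 1))) ` {2..k}" for n
    unfolding \<mu>_def by (rule Min_in) (use k in auto)
  have \<mu>_nonneg: "\<mu> n \<ge> 0" for n using \<mu>_in[of n] by auto
  \<comment> \<open>Clears the roots from the minimum, so that degree bounds with natural exponents
    can be derived from it.\<close>
  have \<mu>_power: "\<mu> n ^ (l - 1) \<le> density (H n) / real (max_deg l (H n))" if l: "l \<in> {2..k}" for n l
  proof -
    let ?x = "density (H n) / real (max_deg l (H n))"
    have x: "?x \<ge> 0" using d0 by simp
    have "\<mu> n \<le> ?x powr (1 / (real l - 1))"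
      unfolding \<mu>_def by (rule Min_le) (use l in auto)
    then have "\<mu> n ^ (l - 1) \<le> (?x powr (1 / (real l - 1))) ^ (l - 1)"
      by (rule power_mono) (rule \<mu>_nonneg)
    also have "\<dots> = ?x powr (1 / (real l - 1) * real (l - 1))"
      using l powr_realpow'[of "?x powr (1 / (real l - 1))" "l - 1"] by (simp add: powr_powr)
    also have "\<dots> = ?x" using l x d0 by (simp add: of_nat_diff)
    finally show ?thesis .
  qed
  obtain c where c: "c > 0" and ev1: "\<forall>\<^sub>F n in sequentially. norm (real (max_deg 1 (H n))) \<le> c * norm (density (H n))"
    using landau_o.bigE[OF M1] by metis
  have ev3: "\<forall>\<^sub>F n in sequentially. norm (density (H n)) \<le> 1 * norm (real (num_verts (H n)) ^ (k - 1))"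
    using landau_o.smallD[OF M3, of 1] by simp
  \<comment> \<open>\<open>c\<close> serves \<open>l = 1\<close> through (M1); for
    \<open>l \<ge> 2\<close> the constant 1 works.\<close>
  define C where "C = max c 1"
  define K where "K = real (k * 2 ^ k * k ^ (2 * k)) * C * real k ^ (2 * k)"
  define \<delta> where "\<delta> = 1 / (2 * K)"
  \<comment> \<open>The divisor \<open>2 * real k\<close> ensures \<open>x \<ge> 2 * real k\<close>
    below, so rounding \<open>x\<close> down leaves at least \<open>k\<close> attempts and loses at
    most a factor 2.\<close>
  define \<epsilon> where "\<epsilon> = \<delta> / (2 * real k)"
  have K: "K > 0" using k by (simp add: K_def C_def)
  have \<delta>: "\<delta> > 0" using K by (simp add: \<delta>_def)
  have \<delta>K: "\<delta> * K < 1" using K by (simp add: \<delta>_def)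
  have \<epsilon>: "\<epsilon> > 0" using \<delta> k by (simp add: \<epsilon>_def)
  have "\<forall>\<^sub>F n in sequentially. \<epsilon> * norm (\<mu> n) \<le> norm (real (threshold_bias (H n)))"
    using ev1 ev3
  proof eventually_elim
    case (elim n)
    define d where "d = density (H n)"
    define v where "v = real (num_verts (H n))"
    define q where "q = threshold_bias (H n)"
    \<comment> \<open>Breaker wins at the threshold itself, so it suffices to refute
      \<open>breaker_wins\<close> at this bias when it lies below
      \<open>\<epsilon> * \<mu> n\<close>.\<close>
    have q: "q > 0" "breaker_wins (H n) q"
      using threshold_bias_pos_wins[OF uniform k, of n] by (auto simp: q_def)
    have "\<epsilon> * \<mu> n \<le> real q"
    proof (rule ccontr)
      assume "\<not> \<epsilon> * \<mu> n \<le> real q"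
      then have q_less: "real q < \<epsilon> * \<mu> n" by simp
      then have \<mu>: "\<mu> n > 0" using \<epsilon> q by (metis less_trans of_nat_0_less_iff zero_less_mult_pos)
      \<comment> \<open>Division by zero yields 0, so \<open>\<mu> n > 0\<close> rules out zero
        degrees as well as hypergraphs without edges, where \<open>max_deg\<close> may be
        unspecified.\<close>
      have pos: "d > 0 \<and> max_deg l (H n) > 0" if "l \<in> {2..k}" for l
      proof -
        have "0 < \<mu> n ^ (l - 1)" using \<mu> by simp
        also have "\<dots> \<le> d / real (max_deg l (H n))" unfolding d_def by (rule \<mu>_power[OF that])
        finally show ?thesis by (auto simp: zero_less_divide_iff)
      qed
      have d: "d > 0" using pos[of 2] k by auto
      then have v: "v > 0" and edges: "hedges (H n) \<noteq> {}"
        by (auto simp: d_def density_def v_def num_edges_def zero_less_divide_iff)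
      \<comment> \<open>At \<open>l = k\<close> the degree is a positive integer, so
        \<open>\<mu> n ^ (k - 1) \<le> d\<close>; then (M3), taken with constant 1, gives
        \<open>\<mu> n \<le> v\<close>, which leaves room for \<open>k\<close> attempts.\<close>
      have "\<mu> n ^ (k - 1) \<le> d / real (max_deg k (H n))" unfolding d_def by (rule \<mu>_power) (use k in auto)
      also have "\<dots> \<le> d" using pos[of k] k d by (simp add: divide_le_eq)
      also have "\<dots> \<le> v ^ (k - 1)" using elim(2) d by (simp add: d_def v_def)
      finally have \<mu>_le: "\<mu> n \<le> v"
        using k v \<mu> by (simp add: power_mono_iff)
      \<comment> \<open>The real number of attempts at which Breaker's possible share reaches
        exactly \<open>\<delta>\<close>.\<close>
      define x where "x = \<delta> * v / real q"
      define M where "M = nat \<lfloor>x\<rfloor>"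
      have q0: "real q > 0" using q(1) by simp
      have k1: "real k \<ge> 1" using k by simp
      have q\<mu>: "real q * (2 * real k) < \<delta> * \<mu> n"
        using q_less k by (simp add: \<epsilon>_def field_simps)
      also have "\<dots> \<le> \<delta> * v" using \<mu>_le \<delta> by simp
      finally have big: "2 * real k \<le> x" using q0 by (simp add: x_def field_simps)
      have M_le: "real M \<le> x" using big unfolding M_def by linarith
      have M_ge: "real M \<ge> x - 1" using big unfolding M_def by linarith
      have kM: "k \<le> M" using big M_ge k1 by linarith
      have half: "x / 2 \<le> real M" using big M_ge k1 by linarith
      \<comment> \<open>The link between bias and degrees: a bias below
        \<open>\<epsilon> * \<mu> n\<close> permits at least \<open>v / \<mu> n\<close> attempts,
        and \<open>\<mu>_power\<close> then becomes the degree bound for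
        \<open>l \<ge> 2\<close>.\<close>
      have p_ge: "1 / \<mu> n \<le> real M / v"
      proof -
        have "real q * 2 \<le> real q * (2 * real k)" using q0 k1 by (intro mult_left_mono) auto
        also note q\<mu>
        finally have "1 / \<mu> n \<le> \<delta> / (real q * 2)" using q0 \<mu> by (simp add: divide_simps mult_ac)
        also have "\<dots> = x / 2 / v" using v by (simp add: x_def)
        also have "\<dots> \<le> real M / v" using half v by (intro divide_right_mono) auto
        finally show ?thesis .
      qed
      have deg: "real (max_deg l (H n)) \<le> C * density (H n) * (real M / real (num_verts (H n))) ^ (l - 1)"
        if l: "l \<in> {1..k}" for l
      proof (cases "l = 1")
        case True
        have "real (max_deg 1 (H n)) \<le> c * d" using elim(1) d by (simp add: d_def)
        also have "\<dots> \<le> C * d" using d by (simp add: C_def)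
        finally show ?thesis using True by (simp add: d_def)
      next
        case False
        then have l2: "l \<in> {2..k}" using l by auto
        have "real (max_deg l (H n)) \<le> d * (1 / \<mu> n) ^ (l - 1)"
          using \<mu>_power[OF l2, of n] pos[OF l2] \<mu> by (simp add: d_def field_simps)
        also have "\<dots> \<le> d * (real M / v) ^ (l - 1)"
          using p_ge d \<mu> by (intro mult_left_mono power_mono) auto
        also have "\<dots> \<le> C * (d * (real M / v) ^ (l - 1))"
          using d v mult_right_mono[of 1 C "d * (real M / v) ^ (l - 1)"] by (simp add: C_def)
        finally show ?thesis by (simp add: d_def v_def)
      qed
      have qM: "real q * real M \<le> \<delta> * real (num_verts (H n))"
        using M_le q0 by (simp add: v_def x_def field_simps)
      have "\<not> breaker_wins (H n) q"
        by (rule not_breaker_wins[OF uniform edges _ kM _ deg qM \<delta>K[unfolded K_def]])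
           (use k in \<open>auto simp: C_def\<close>)
      then show False using q by blast
    qed
    then show ?case using \<mu>_nonneg by (simp add: q_def)
  qed
  then show ?thesis unfolding \<mu>_def[symmetric] by (rule landau_omega.bigI[OF \<epsilon>])
qed

end
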